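(* Let $p,q$ be two distinct primes with $q\mid p-1$. Let $x$ be a generator of the cyclic group $\mathbb{Z}_{q^2}$, let $\psi\in\mathsf{Aut}(\mathbb{Z}_p)$ be an automorphism of order $q$, and let $\varphi:\mathbb{Z}_{q^2}\to\mathsf{Aut}(\mathbb{Z}_p)$ be the homomorphism with $\varphi(x)=\psi$. Then the group $\mathbb{Z}_{p^2}\times(\mathbb{Z}_p\rtimes_\varphi\mathbb{Z}_{q^2})$ is a minimal imperfect group.
   Context: For a group $G$, the power graph $\mathsf{Pow}(G)$ has vertex set $G$, with distinct $a,b$ adjacent iff $a\in\langle b\rangle$ or $b\in\langle a\rangle$. The enhanced power graph $\mathsf{EPow}(G)$ has vertex set $G$, with distinct $a,b$ adjacent iff $\langle a,b\rangle$ is cyclic. The difference graph $D(G)$ is the graph $\mathsf{EPow}(G)-\mathsf{Pow}(G)$ with all isolated vertices removed; thus $x\sim y$ in $D(G)$ iff $\langle x,y\rangle$ is cyclic, $x\notin\langle y\rangle$ and $y\notin\langle x\rangle$. A group $G$ is called a minimal imperfect group if $D(G)$ is not perfect and $D(H)$ is perfect for every proper subgroup $H$ of $G$. The semidirect product $N\rtimes_\varphi K$ has multiplication $(a_1,a_2)(b_1,b_2)=(a_1\varphi(a_2)(b_1),a_2b_2)$. *)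

theory Defs
  imports
    "HOL-Algebra.Algebra"
    "HOL-Library.Ramsey"
    "HOL-Library.Extended_Nat"
begin

section \<open>Graphs\<close>

text \<open>
  A simple graph is a pair of a vertex set and a set of edges, each edge being a two-element set
  of vertices, so that \<^const>\<open>clique\<close> from the Ramsey library applies to its edge set.
\<close>

type_synonym 'a sgraph = "'a set \<times> 'a set set"

abbreviation verts :: "'a sgraph \<Rightarrow> 'a set" where "verts \<equiv> fst"
abbreviation edges :: "'a sgraph \<Rightarrow> 'a set set" where "edges \<equiv> snd"

definition induced :: "'a sgraph \<Rightarrow> 'a set \<Rightarrow> 'a sgraph" where
  "induced \<Gamma> S = (S, {e \<in> edges \<Gamma>. e \<subseteq> S})"

definition remove_isolated :: "'a sgraph \<Rightarrow> 'a sgraph" where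
  "remove_isolated \<Gamma> = ({v \<in> verts \<Gamma>. \<exists>e \<in> edges \<Gamma>. v \<in> e}, edges \<Gamma>)"

definition colourable :: "'a sgraph \<Rightarrow> nat \<Rightarrow> bool" where
  "colourable \<Gamma> k \<longleftrightarrow>
     (\<exists>c \<in> verts \<Gamma> \<rightarrow> {..<k}. \<forall>u \<in> verts \<Gamma>. \<forall>v \<in> verts \<Gamma>. {u, v} \<in> edges \<Gamma> \<longrightarrow> c u \<noteq> c v)"

text \<open>
  Both invariants take values in \<^typ>\<open>enat\<close>, so that they need no finiteness assumption;
  for a finite graph they are the usual natural numbers (both 0 for the graph without vertices).
\<close>

definition chromatic_number :: "'a sgraph \<Rightarrow> enat" where
  "chromatic_number \<Gamma> = (INF k \<in> {k. colourable \<Gamma> k}. enat k)"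

definition clique_number :: "'a sgraph \<Rightarrow> enat" where
  "clique_number \<Gamma> =
     (SUP K \<in> {K. K \<subseteq> verts \<Gamma> \<and> finite K \<and> clique K (edges \<Gamma>)}. enat (card K))"

definition perfect :: "'a sgraph \<Rightarrow> bool" where
  "perfect \<Gamma> \<longleftrightarrow>
     (\<forall>S \<subseteq> verts \<Gamma>. chromatic_number (induced \<Gamma> S) = clique_number (induced \<Gamma> S))"


section \<open>Graphs of groups\<close>

definition power_graph :: "('a, 'b) monoid_scheme \<Rightarrow> 'a sgraph" where
  "power_graph G =
     (carrier G,
      {{a, b} | a b. a \<in> carrier G \<and> b \<in> carrier G \<and> a \<noteq> b \<and>
                     (a \<in> generate G {b} \<or> b \<in> generate G {a})})"

definition enhanced_power_graph :: "('a, 'b) monoid_scheme \<Rightarrow> 'a sgraph" where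
  "enhanced_power_graph G =
     (carrier G,
      {{a, b} | a b. a \<in> carrier G \<and> b \<in> carrier G \<and> a \<noteq> b \<and>
                     cyclic_group (subgroup_generated G {a, b})})"

definition difference_graph :: "('a, 'b) monoid_scheme \<Rightarrow> 'a sgraph" where
  "difference_graph G =
     remove_isolated (carrier G, edges (enhanced_power_graph G) - edges (power_graph G))"

definition minimal_imperfect_group :: "('a, 'b) monoid_scheme \<Rightarrow> bool" where
  "minimal_imperfect_group G \<longleftrightarrow>
     group G \<and> \<not> perfect (difference_graph G) \<and>
     (\<forall>H. subgroup H G \<and> H \<noteq> carrier G \<longrightarrow> perfect (difference_graph (G\<lparr>carrier := H\<rparr>)))"


section \<open>Semidirect products\<close>

definition semidirect_product ::
  "('a, 'c) monoid_scheme \<Rightarrow> ('b \<Rightarrow> 'a \<Rightarrow> 'a) \<Rightarrow> ('b, 'd) monoid_scheme \<Rightarrow> ('a \<times> 'b) monoid" where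
  "semidirect_product N \<phi> K =
     \<lparr>carrier = carrier N \<times> carrier K,
      monoid.mult = (\<lambda>(a1, a2) (b1, b2). (a1 \<otimes>\<^bsub>N\<^esub> \<phi> a2 b1, a2 \<otimes>\<^bsub>K\<^esub> b2)),
      one = (\<one>\<^bsub>N\<^esub>, \<one>\<^bsub>K\<^esub>)\<rparr>"

end

theory Submission
  imports Defs
begin

text \<open>
  Orient the edges of \<open>D(H)\<close> by increasing exponent of \<open>p\<close> in the element order. All orders divide
  \<open>p\<^sup>2q\<^sup>2\<close>, so this orientation is transitive, and \<open>D(H)\<close> is perfect as a comparability graph, as soon as
  elements of order \<open>q\<^sup>2\<close> commute with elements of order \<open>p\<^sup>2\<close>. Two such elements that do not commute
  generate the whole group, hence proper subgroups are fine. In the whole group, let \<open>y\<close> and \<open>z\<close> be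
  non-commuting elements of orders \<open>q\<^sup>2\<close> and \<open>p\<^sup>2\<close> such that \<open>y\<^sup>q\<close> commutes with \<open>z\<close> and \<open>z\<^sup>p\<close> with
  \<open>y\<close>; then \<open>z\<^sup>py\<^sup>q\<close>, \<open>y\<close>, \<open>z\<^sup>p\<close>, \<open>y\<^sup>q\<close>, \<open>z\<close> is an induced 5-cycle.
\<close>

section \<open>Perfect graphs\<close>

text \<open>A proper colouring is injective on a clique, so every clique has at most as many
  elements as there are colours.\<close>

lemma clique_number_le_chromatic_number: "clique_number \<Gamma> \<le> chromatic_number \<Gamma>"
proof -
  have "card K \<le> k" if "K \<subseteq> verts \<Gamma>" "finite K" "clique K (edges \<Gamma>)" "colourable \<Gamma> k" for K k
  proof -
    obtain c where c: "c \<in> verts \<Gamma> \<rightarrow> {..<k}"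
        "\<And>u v. u \<in> verts \<Gamma> \<Longrightarrow> v \<in> verts \<Gamma> \<Longrightarrow> {u, v} \<in> edges \<Gamma> \<Longrightarrow> c u \<noteq> c v"
      using \<open>colourable \<Gamma> k\<close> unfolding colourable_def by blast
    have "inj_on c K"
      using c(2) that(1,3) unfolding inj_on_def clique_def by blast
    moreover have "c ` K \<subseteq> {..<k}"
      using c(1) that(1) by blast
    ultimately show ?thesis
      by (metis card_inj_on_le card_lessThan finite_lessThan)
  qed
  then show ?thesis
    unfolding clique_number_def chromatic_number_def
    by (intro SUP_least INF_greatest) auto
qed

lemma edges_induced_iff:
  "{u, v} \<in> edges (induced \<Gamma> S) \<longleftrightarrow> {u, v} \<in> edges \<Gamma> \<and> u \<in> S \<and> v \<in> S"
  by (auto simp: induced_def)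

text \<open>
  Colouring each vertex by the size of the largest chain ending in it uses as many colours as
  there are elements in a largest chain, and chains are cliques.
\<close>

lemma perfect_if_comparability_graph:
  assumes fin: "finite (verts \<Gamma>)"
    and edges: "\<And>u v. u \<in> verts \<Gamma> \<Longrightarrow> v \<in> verts \<Gamma> \<Longrightarrow> {u, v} \<in> edges \<Gamma> \<longleftrightarrow> R u v \<or> R v u"
    and irrefl: "\<And>u. u \<in> verts \<Gamma> \<Longrightarrow> \<not> R u u"
    and trans: "\<And>u v w. \<lbrakk>u \<in> verts \<Gamma>; v \<in> verts \<Gamma>; w \<in> verts \<Gamma>; R u v; R v w\<rbrakk> \<Longrightarrow> R u w"
  shows "perfect \<Gamma>"
  unfolding perfect_def
proof (intro allI impI)
  fix S assume S: "S \<subseteq> verts \<Gamma>"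
  have finS: "finite S"
    using fin S by (rule rev_finite_subset)
  \<comment> \<open>In a clique any two elements are \<open>R\<close>-comparable, so these are the
    \<open>R\<close>-chains with top element \<open>v\<close>.\<close>
  define chains where
    "chains v = {K. K \<subseteq> S \<and> clique K (edges \<Gamma>) \<and> v \<in> K \<and> (\<forall>u\<in>K. u = v \<or> R u v)}" for v
  define h where "h v = Max (card ` chains v)" for v
  have fin_chains: "finite (chains v)" for v
    by (rule finite_subset[of _ "Pow S"]) (auto simp: chains_def finS)
  have card_le_h: "card K \<le> h v" if "K \<in> chains v" for K v
    unfolding h_def using that fin_chains by simp
  have singleton: "{v} \<in> chains v" if "v \<in> S" for v
    using that by (auto simp: chains_def clique_def)
  have h_pos: "1 \<le> h v" if "v \<in> S" for v
    using card_le_h[OF singleton[OF that]] by simp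
  have ex_chain: "\<exists>K\<in>chains v. card K = h v" if "v \<in> S" for v
  proof -
    have "h v \<in> card ` chains v"
      unfolding h_def using singleton[OF that] fin_chains by (intro Max_in) auto
    then show ?thesis by auto
  qed
  \<comment> \<open>A largest chain with top \<open>u\<close> is extended by \<open>v\<close>:
    transitivity puts all its members below \<open>v\<close>, and irreflexivity keeps
    \<open>v\<close> out of it.\<close>
  have h_less: "h u < h v" if uv: "u \<in> S" "v \<in> S" "R u v" for u v
  proof -
    obtain K where K: "K \<in> chains u" "card K = h u"
      using ex_chain[OF \<open>u \<in> S\<close>] by blast
    have KS: "K \<subseteq> S" and below: "\<And>w. w \<in> K \<Longrightarrow> w = u \<or> R w u"
      using K(1) unfolding chains_def by blast+
    have RK: "R w v" if "w \<in> K" for w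
    proof -
      have "w \<in> verts \<Gamma>" "u \<in> verts \<Gamma>" "v \<in> verts \<Gamma>"
        using KS that uv S by blast+
      then show ?thesis
        using below[OF that] trans \<open>R u v\<close> by blast
    qed
    then have "v \<notin> K"
      using irrefl S uv(2) by blast
    moreover have "{w, v} \<in> edges \<Gamma>" if "w \<in> K" for w
      using RK[OF that] edges KS S uv(2) that by blast
    then have "insert v K \<in> chains v"
      using K(1) RK uv(2) unfolding chains_def clique_def by (auto simp: insert_commute)
    ultimately show ?thesis
      using card_le_h[of "insert v K" v] K(2) finite_subset[OF KS finS] by simp
  qed
  \<comment> \<open>The inserted 0 is the number of colours for empty \<open>S\<close>, where
    \<open>h\<close> has no value to take the maximum of.\<close>
  define k where "k = Max (insert 0 (h ` S))"
  have h_le: "h v \<le> k" if "v \<in> S" for v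
    unfolding k_def using that finS by simp
  have "colourable (induced \<Gamma> S) k"
    unfolding colourable_def
  \<comment> \<open>The values of \<open>h\<close> run from 1 to \<open>k\<close>, the colours from
    0 to \<open>k - 1\<close>. As \<open>h\<close> is positive on \<open>S\<close>, truncated
    subtraction keeps different values different.\<close>
  proof (intro bexI[of _ "\<lambda>v. h v - 1"] ballI impI)
    show "(\<lambda>v. h v - 1) \<in> verts (induced \<Gamma> S) \<rightarrow> {..<k}"
      using h_pos h_le by (fastforce simp: induced_def)
  next
    fix u v
    assume "u \<in> verts (induced \<Gamma> S)" "v \<in> verts (induced \<Gamma> S)" "{u, v} \<in> edges (induced \<Gamma> S)"
    then have uv: "u \<in> S" "v \<in> S" and "R u v \<or> R v u"
      using edges S by (auto simp: edges_induced_iff)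
    then show "h u - 1 \<noteq> h v - 1"
      using h_less[of u v] h_less[of v u] h_pos[of u] h_pos[of v] by force
  qed
  then have "chromatic_number (induced \<Gamma> S) \<le> enat k"
    unfolding chromatic_number_def by (intro INF_lower) simp
  also have "enat k \<le> clique_number (induced \<Gamma> S)"
  proof -
    have "k \<in> insert 0 (h ` S)"
      unfolding k_def using finS by (intro Max_in) auto
    then obtain K where "K \<subseteq> S" "clique K (edges \<Gamma>)" "card K = k"
    proof (elim insertE imageE)
      assume "k = 0"
      then show thesis using that[of "{}"] by simp
    next
      fix v assume "k = h v" "v \<in> S"
      then show thesis using that ex_chain unfolding chains_def by blast
    qed
    moreover from this have "clique K (edges (induced \<Gamma> S))"
      unfolding clique_def by (auto simp: edges_induced_iff)
    ultimately show ?thesis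
      unfolding clique_number_def using finite_subset[OF _ finS]
      by (intro SUP_upper2[of K]) (auto simp: induced_def)
  qed
  finally show "chromatic_number (induced \<Gamma> S) = clique_number (induced \<Gamma> S)"
    using clique_number_le_chromatic_number by (rule antisym)
qed

text \<open>A 5-cycle has no triangle and odd length, so its clique number is at most 2 and its
  chromatic number at least 3. Distinctness of the five vertices follows from \<open>E\<close> and
  \<open>N\<close>: identifying two of them would make an edge coincide with a non-edge.\<close>

lemma not_perfect_if_induced_5_cycle:
  assumes V: "{a, b, c, d, e} \<subseteq> verts \<Gamma>"
    and E: "{a, b} \<in> edges \<Gamma>" "{b, c} \<in> edges \<Gamma>" "{c, d} \<in> edges \<Gamma>" "{d, e} \<in> edges \<Gamma>"
      "{e, a} \<in> edges \<Gamma>"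
    and N: "{a, c} \<notin> edges \<Gamma>" "{b, d} \<notin> edges \<Gamma>" "{c, e} \<notin> edges \<Gamma>" "{d, a} \<notin> edges \<Gamma>"
      "{e, b} \<notin> edges \<Gamma>"
  shows "\<not> perfect \<Gamma>"
proof
  let ?S = "{a, b, c, d, e}"
  assume "perfect \<Gamma>"
  then have eq: "chromatic_number (induced \<Gamma> ?S) = clique_number (induced \<Gamma> ?S)"
    using V unfolding perfect_def by blast
  \<comment> \<open>Any three of the five vertices include two at distance 2 on the cycle, and those
    are not joined.\<close>
  have "card K \<le> 2" if K: "K \<subseteq> ?S" "clique K (edges \<Gamma>)" for K
  proof (rule ccontr)
    assume "\<not> card K \<le> 2"
    then have "3 \<le> card K" by simp
    then obtain T where T: "T \<subseteq> K" "card T = 3"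
      by (meson obtain_subset_with_card_n)
    then obtain x y z where T_eq: "T = {x, y, z}" and ne: "x \<noteq> y" "y \<noteq> z" "x \<noteq> z"
      by (auto simp: card_3_iff)
    have xyz: "x \<in> ?S" "y \<in> ?S" "z \<in> ?S"
      using T(1) K(1) T_eq by blast+
    have "{x, y} \<in> edges \<Gamma>" "{y, z} \<in> edges \<Gamma>" "{x, z} \<in> edges \<Gamma>"
      using K(2) T(1) T_eq ne unfolding clique_def by blast+
    moreover have "{c, a} \<notin> edges \<Gamma>" "{d, b} \<notin> edges \<Gamma>" "{e, c} \<notin> edges \<Gamma>" "{a, d} \<notin> edges \<Gamma>"
      "{b, e} \<notin> edges \<Gamma>"
      using N by (simp_all add: insert_commute)
    ultimately show False
      using xyz ne N by auto
  qed
  then have "clique_number (induced \<Gamma> ?S) \<le> enat 2"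
    unfolding clique_number_def
    by (intro SUP_least) (auto simp: induced_def clique_def)
  \<comment> \<open>Two colours would have to alternate around a cycle of odd length.\<close>
  moreover have "3 \<le> k" if "colourable (induced \<Gamma> ?S) k" for k
  proof (rule ccontr)
    assume "\<not> 3 \<le> k"
    then have "k \<le> 2" by simp
    have verts: "verts (induced \<Gamma> ?S) = ?S"
      by (simp add: induced_def)
    obtain col where "col \<in> ?S \<rightarrow> {..<k}"
      and col: "\<And>u v. u \<in> ?S \<Longrightarrow> v \<in> ?S \<Longrightarrow> {u, v} \<in> edges \<Gamma> \<Longrightarrow> col u \<noteq> col v"
      using \<open>colourable (induced \<Gamma> ?S) k\<close> unfolding colourable_def edges_induced_iff verts
      by blast
    then have "col a < k" "col b < k" "col c < k" "col d < k" "col e < k"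
      by (simp_all add: Pi_iff)
    then have "col a < 2" "col b < 2" "col c < 2" "col d < 2" "col e < 2"
      using \<open>k \<le> 2\<close> by simp_all
    moreover have "col a \<noteq> col b" "col b \<noteq> col c" "col c \<noteq> col d" "col d \<noteq> col e" "col e \<noteq> col a"
      using E by (intro col; blast)+
    ultimately show False by linarith
  qed
  then have "enat 3 \<le> chromatic_number (induced \<Gamma> ?S)"
    unfolding chromatic_number_def by (intro INF_greatest) auto
  ultimately show False
    using eq order_trans[of "enat 3" "chromatic_number (induced \<Gamma> ?S)" "enat 2"] by simp
qed

section \<open>Difference graphs\<close>

text \<open>Removing isolated vertices keeps all edges, and \<open>a \<noteq> b\<close> follows from
  \<open>a \<notin> generate G {b}\<close>. Cyclicity is rephrased through a generator: an element
  \<open>g\<close> of the subgroup generated by \<open>a\<close> and \<open>b\<close> generates that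
  subgroup as soon as both are powers of \<open>g\<close>.\<close>

lemma edges_difference_graph_iff:
  assumes "group G" "a \<in> carrier G" "b \<in> carrier G"
  shows "{a, b} \<in> edges (difference_graph G) \<longleftrightarrow>
    (\<exists>g \<in> generate G {a, b}. a \<in> generate G {g} \<and> b \<in> generate G {g}) \<and>
    a \<notin> generate G {b} \<and> b \<notin> generate G {a}"
proof -
  interpret group G by fact
  have "cyclic_group (subgroup_generated G {a, b}) \<longleftrightarrow>
      (\<exists>g \<in> generate G {a, b}. a \<in> generate G {g} \<and> b \<in> generate G {g})" (is "?L \<longleftrightarrow> ?R")
  proof
    assume ?L
    then obtain g where g: "g \<in> generate G {a, b}"
        "subgroup_generated (subgroup_generated G {a, b}) {g} = subgroup_generated G {a, b}"
      unfolding cyclic_group_def carrier_subgroup_generated using assms by auto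
    have "generate G {g} = generate G {a, b}"
      using arg_cong[OF g(2), of carrier] g(1) assms
        generate_consistent[OF _ generate_is_subgroup, of "{g}" "{a, b}"]
      by (simp add: subgroup_generated_def)
    moreover have "a \<in> generate G {a, b}" "b \<in> generate G {a, b}"
      by (auto intro: generate.incl)
    ultimately show ?R
      using g(1) by auto
  next
    assume ?R
    then obtain g where g: "g \<in> generate G {a, b}" "a \<in> generate G {g}" "b \<in> generate G {g}"
      by blast
    have gG: "g \<in> carrier G"
      using g(1) assms generate_in_carrier[of "{a, b}"] by blast
    have "generate G {a, b} = generate G {g}"
      using g gG assms
      by (intro equalityI generate_subgroup_incl generate_is_subgroup) auto
    then have "subgroup_generated G {a, b} = subgroup_generated G {g}"
      using gG assms by (simp add: subgroup_generated_def)
    then show ?L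
      using cyclic_group_generated by simp
  qed
  then show ?thesis
    using assms generate.incl[of a "{a}" G]
    by (auto simp: difference_graph_def remove_isolated_def enhanced_power_graph_def
        power_graph_def doubleton_eq_iff insert_commute[of b a])
qed

lemma verts_difference_graph:
  "verts (difference_graph G) = {v \<in> carrier G. \<exists>e \<in> edges (difference_graph G). v \<in> e}"
  by (simp add: difference_graph_def remove_isolated_def)

section \<open>Orders of elements and cyclic subgroups\<close>

context group
begin

lemma ord_dvd_if_mem_generate:
  assumes "b \<in> carrier G" "a \<in> generate G {b}"
  shows "ord a dvd ord b"
proof -
  obtain k :: int where k: "a = b [^] k"
    using assms generate_pow by auto
  have "a [^] int (ord b) = (b [^] int (ord b)) [^] k"
    unfolding k using assms(1) by (simp only: int_pow_pow mult.commute)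
  then have "a [^] ord b = \<one>"
    using assms(1) by (simp add: int_pow_int)
  then show ?thesis
    using assms k pow_eq_id by auto
qed

text \<open>A finite cyclic group has one subgroup for each divisor of its order, and inclusion of
  these subgroups is divisibility of their orders. With \<open>n = ord g\<close>, the orders of
  \<open>g [^] i\<close> and \<open>g [^] j\<close> are \<open>n\<close> divided by the respective
  gcd, so the hypothesis says that \<open>gcd n j\<close> divides \<open>gcd n i\<close>.\<close>

lemma mem_generate_if_ord_dvd:
  assumes fin: "finite (carrier G)" and g: "g \<in> carrier G"
    and a: "a \<in> generate G {g}" and b: "b \<in> generate G {g}" and dvd: "ord a dvd ord b"
  shows "a \<in> generate G {b}"
proof -
  obtain i j :: nat where ij: "a = g [^] i" "b = g [^] j"
    using a b generate_pow_on_finite_carrier[OF fin g] by auto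
  define n where "n = ord g"
  have n: "n > 0"
    using ord_ge_1[OF fin g] by (simp add: n_def)
  have ord: "ord (g [^] k) = n div gcd n k" for k
    using ord_pow_gen[OF g, of k] n by (simp add: n_def)
  \<comment> \<open>The cofactors \<open>A\<close> and \<open>B\<close> are the orders of
    \<open>a\<close> and \<open>b\<close>.\<close>
  obtain A where A: "n = gcd n i * A" by (meson dvd_def gcd_dvd1)
  obtain B where B: "n = gcd n j * B" by (meson dvd_def gcd_dvd1)
  have "n div gcd n i = A" "n div gcd n j = B"
    using n A B by (metis gcd_pos_nat nonzero_mult_div_cancel_left neq0_conv)+
  then have "A dvd B"
    using dvd unfolding ij ord by simp
  then obtain t where "B = A * t" by blast
  then have "gcd n i * A = gcd n j * t * A"
    using A B by (simp add: algebra_simps)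
  then have "gcd n i = gcd n j * t"
    using n A by (metis mult_0_right mult_cancel2 neq0_conv)
  then have "gcd n j dvd i"
    by (metis dvd_trans dvd_triv_left gcd_dvd2)
  then obtain s where s: "i = gcd n j * s" by blast
  \<comment> \<open>By Bezout, \<open>gcd n j\<close> is a multiple of \<open>j\<close> modulo
    \<open>n\<close>; hence so is its multiple \<open>i\<close>, and \<open>g [^] i\<close> is a
    power of \<open>b\<close>.\<close>
  obtain u v where uv: "u * int n + v * int j = gcd (int n) (int j)"
    using bezout_int by blast
  have i: "int i = int n * (u * s) + int j * (v * s)"
    using arg_cong[OF uv, of "\<lambda>m. m * int s"] s by (simp add: algebra_simps flip: gcd_int_int_eq)
  have "g [^] int n = \<one>"
    unfolding int_pow_int n_def using g by simp
  have "a = g [^] int i"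
    by (simp add: ij int_pow_int)
  also have "\<dots> = (g [^] int n) [^] (u * s) \<otimes> (g [^] int j) [^] (v * s)"
    unfolding i using g by (simp only: int_pow_mult int_pow_pow)
  also have "\<dots> = b [^] (v * s)"
    unfolding \<open>g [^] int n = \<one>\<close> ij(2) int_pow_int[symmetric] using g by simp
  finally show ?thesis
    using generate_pow[of b] ij g by auto
qed

text \<open>If \<open>u * ord a + v * ord b = 1\<close>, then raising \<open>a \<otimes> b\<close>
  to the power \<open>v * ord b\<close> kills the factor \<open>b\<close> and fixes
  \<open>a\<close>. Exchanging the roles gives the second claim.\<close>

lemma mem_generate_mult:
  assumes "a \<in> carrier G" "b \<in> carrier G" "a \<otimes> b = b \<otimes> a" "coprime (ord a) (ord b)"
  shows "a \<in> generate G {a \<otimes> b}" "b \<in> generate G {a \<otimes> b}"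
proof -
  have *: "a \<in> generate G {a \<otimes> b}"
    if ab: "a \<in> carrier G" "b \<in> carrier G" "a \<otimes> b = b \<otimes> a" "coprime (ord a) (ord b)" for a b
  proof -
    obtain u v where uv: "u * int (ord a) + v * int (ord b) = 1"
      using ab(4) bezout_int[of "int (ord a)" "int (ord b)"] by (auto simp: coprime_iff_gcd_eq_1)
    have pows: "a [^] int (ord a) = \<one>" "b [^] int (ord b) = \<one>"
      using ab by (simp_all add: int_pow_int)
    have "(a \<otimes> b) [^] (v * int (ord b)) = a [^] (v * int (ord b)) \<otimes> (b [^] int (ord b)) [^] v"
      using ab by (subst int_pow_mult_distrib) (simp_all only: int_pow_pow mult.commute)
    also have "\<dots> = a [^] (1 - u * int (ord a))"
      using ab pows uv by (simp add: algebra_simps) (metis add_diff_cancel_left')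
    also have "\<dots> = a \<otimes> inv ((a [^] int (ord a)) [^] u)"
      using ab by (simp only: int_pow_diff int_pow_pow int_pow_1 mult.commute)
    finally have "(a \<otimes> b) [^] (v * int (ord b)) = a"
      using ab pows by simp
    then show ?thesis
      using ab generate_pow[of "a \<otimes> b"] by (metis (mono_tags, lifting) UNIV_I m_closed mem_Collect_eq)
  qed
  show "a \<in> generate G {a \<otimes> b}"
    using * assms by blast
  show "b \<in> generate G {a \<otimes> b}"
    using *[of b a] assms by (simp add: coprime_commute)
qed

lemma ord_eq_prime_square:
  assumes "a \<in> carrier G" "Factorial_Ring.prime (p::nat)" "a [^] (p\<^sup>2) = \<one>" "a [^] p \<noteq> \<one>"
  shows "ord a = p\<^sup>2"
proof -
  have "ord a dvd p\<^sup>2" "\<not> ord a dvd p"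
    using assms pow_eq_id by auto
  then obtain i where i: "i \<le> 2" "ord a = p ^ i"
    using divides_primepow_nat[OF assms(2)] by auto
  then show ?thesis
    using \<open>\<not> ord a dvd p\<close> by (cases "i = 0"; cases "i = 1") (auto simp: eval_nat_numeral dest: le_antisym)
qed

end

lemma not_dvd_square_of_prime:
  assumes "Factorial_Ring.prime (p::nat)" "Factorial_Ring.prime q" "p \<noteq> q"
  shows "\<not> p dvd q\<^sup>2"
  using assms prime_dvd_power primes_dvd_imp_eq by blast

lemma dvd_prime_squares_imp_exponents:
  assumes "Factorial_Ring.prime (p::nat)" "Factorial_Ring.prime q" "n dvd p\<^sup>2 * q\<^sup>2"
  shows "\<exists>i j. i \<le> 2 \<and> j \<le> 2 \<and> n = p ^ i * q ^ j"
proof -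
  obtain m k where "n = m * k" "m dvd p\<^sup>2" "k dvd q\<^sup>2"
    using assms(3) dvd_productE by metis
  then show ?thesis
    using divides_primepow_nat[OF assms(1)] divides_primepow_nat[OF assms(2)] by metis
qed

section \<open>Adjacency through element orders, and the two perfection criteria\<close>

context group
begin

text \<open>Adjacent elements are powers of one element, and there divisibility of orders would make
  one a power of the other.\<close>

lemma ord_dvd_incomparable_if_adjacent:
  assumes fin: "finite (carrier G)" and ab: "a \<in> carrier G" "b \<in> carrier G"
    and adj: "{a, b} \<in> edges (difference_graph G)"
  shows "\<not> ord a dvd ord b" "\<not> ord b dvd ord a"
proof -
  obtain g where g: "g \<in> generate G {a, b}" "a \<in> generate G {g}" "b \<in> generate G {g}"
      and "a \<notin> generate G {b}" "b \<notin> generate G {a}"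
    using adj unfolding edges_difference_graph_iff[OF is_group ab] by blast
  moreover have "g \<in> carrier G"
    using g(1) ab generate_in_carrier[of "{a, b}"] by blast
  ultimately show "\<not> ord a dvd ord b" "\<not> ord b dvd ord a"
    using mem_generate_if_ord_dvd[OF fin] by blast+
qed

text \<open>A power has an order dividing that of its base, so incomparable orders exclude both
  memberships, and \<open>g\<close> witnesses cyclicity.\<close>

lemma adjacentI:
  assumes "a \<in> carrier G" "b \<in> carrier G" "\<not> ord a dvd ord b" "\<not> ord b dvd ord a"
    and "g \<in> generate G {a, b}" "a \<in> generate G {g}" "b \<in> generate G {g}"
  shows "{a, b} \<in> edges (difference_graph G)"
  using assms ord_dvd_if_mem_generate
  unfolding edges_difference_graph_iff[OF is_group assms(1,2)] by blast

text \<open>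
  Along an oriented edge the exponent of \<open>q\<close> decreases. As both exponents are at most 2, a path of
  length 2 leads from an element of order \<open>q\<^sup>2\<close> to one of order \<open>p\<^sup>2\<close>, which is where commutation is used.
\<close>

lemma perfect_difference_graph_if_commuting:
  assumes fin: "finite (carrier G)"
    and pq: "Factorial_Ring.prime (p::nat)" "Factorial_Ring.prime q" "p \<noteq> q"
    and exponent: "\<And>a. a \<in> carrier G \<Longrightarrow> ord a dvd p\<^sup>2 * q\<^sup>2"
    and comm: "\<And>a b. \<lbrakk>a \<in> carrier G; b \<in> carrier G; ord a = q\<^sup>2; ord b = p\<^sup>2\<rbrakk> \<Longrightarrow> a \<otimes> b = b \<otimes> a"
  shows "perfect (difference_graph G)"
proof -
  let ?E = "edges (difference_graph G)"
  have "\<exists>i j. i \<le> 2 \<and> j \<le> 2 \<and> ord a = p ^ i * q ^ j" if "a \<in> carrier G" for a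
    using dvd_prime_squares_imp_exponents[OF pq(1,2) exponent[OF that]] .
  then obtain i j where ij: "\<And>a. a \<in> carrier G \<Longrightarrow> i a \<le> 2 \<and> j a \<le> 2 \<and> ord a = p ^ i a * q ^ j a"
    by metis
  define R where "R a b \<longleftrightarrow> {a, b} \<in> ?E \<and> i a < i b" for a b
  have sub: "verts (difference_graph G) \<subseteq> carrier G"
    by (auto simp: verts_difference_graph)
  \<comment> \<open>If both exponents of one element were at most those of the other, its order
    would divide the other order.\<close>
  have incomparable: "i a < i b \<and> j b < j a \<or> i b < i a \<and> j a < j b"
    if "a \<in> carrier G" "b \<in> carrier G" "{a, b} \<in> ?E" for a b
  proof -
    have "\<not> (i a \<le> i b \<and> j a \<le> j b)" "\<not> (i b \<le> i a \<and> j b \<le> j a)"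
      using ord_dvd_incomparable_if_adjacent[OF fin that] ij[OF that(1)] ij[OF that(2)]
      by (metis le_imp_power_dvd mult_dvd_mono)+
    then show ?thesis by linarith
  qed
  show ?thesis
  proof (rule perfect_if_comparability_graph[where R = R])
    show "finite (verts (difference_graph G))"
      using fin sub by (rule rev_finite_subset)
  next
    fix a b assume ab: "a \<in> verts (difference_graph G)" "b \<in> verts (difference_graph G)"
    then show "{a, b} \<in> ?E \<longleftrightarrow> R a b \<or> R b a"
      using incomparable[of a b] sub unfolding R_def by (auto simp: insert_commute[of b a])
  next
    fix a b c
    assume V: "a \<in> verts (difference_graph G)" "b \<in> verts (difference_graph G)"
        "c \<in> verts (difference_graph G)" and R: "R a b" "R b c"
    then have car: "a \<in> carrier G" "b \<in> carrier G" "c \<in> carrier G"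
      using sub by blast+
    have "i a < i b" "i b < i c" "j b < j a" "j c < j b"
      using R incomparable[OF car(1,2)] incomparable[OF car(2,3)] unfolding R_def by auto
    then have ijs: "i a = 0" "j a = 2" "i c = 2" "j c = 0"
      using ij[OF car(1)] ij[OF car(3)] by linarith+
    then have ord: "ord a = q\<^sup>2" "ord c = p\<^sup>2"
      using ij[OF car(1)] ij[OF car(3)] by auto
    have coprime: "coprime (q\<^sup>2) (p\<^sup>2)"
      using pq primes_coprime by (metis coprime_power_left_iff coprime_power_right_iff)
    have ac: "a \<otimes> c = c \<otimes> a"
      using comm car ord by blast
    \<comment> \<open>As \<open>a\<close> and \<open>c\<close> commute and have coprime orders,
      \<open>a \<otimes> c\<close> generates both.\<close>
    have "{a, c} \<in> ?E"
    proof (rule adjacentI[where g = "a \<otimes> c"])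
      show "\<not> ord a dvd ord c" "\<not> ord c dvd ord a"
        using pq not_dvd_square_of_prime unfolding ord by (metis dvd_power dvd_trans zero_less_numeral)+
      show "a \<otimes> c \<in> generate G {a, c}"
        by (intro generate.eng generate.incl) auto
      show "a \<in> generate G {a \<otimes> c}" "c \<in> generate G {a \<otimes> c}"
        using mem_generate_mult[OF car(1,3) ac] coprime ord by simp_all
    qed (use car in auto)
    then show "R a c"
      using ijs unfolding R_def by simp
  qed (simp add: R_def)
qed

text \<open>The vertices \<open>w\<close>, \<open>y\<close>, \<open>u\<close>, \<open>v\<close>,
  \<open>z\<close> in cyclic order have orders \<open>p * q\<close>, \<open>q\<^sup>2\<close>,
  \<open>p\<close>, \<open>q\<close>, \<open>p\<^sup>2\<close>. Neighbours have incomparable orders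
  and a common cyclic overgroup. Each chord joins elements of comparable orders, except the one from
  \<open>z\<close> to \<open>y\<close>, which fail to commute.\<close>

lemma not_perfect_difference_graph_if_not_commuting:
  assumes fin: "finite (carrier G)"
    and pq: "Factorial_Ring.prime (p::nat)" "Factorial_Ring.prime q" "p \<noteq> q"
    and yz: "y \<in> carrier G" "z \<in> carrier G" "ord y = q\<^sup>2" "ord z = p\<^sup>2" "y \<otimes> z \<noteq> z \<otimes> y"
    and comm: "(z [^] p) \<otimes> y = y \<otimes> (z [^] p)" "(y [^] q) \<otimes> z = z \<otimes> (y [^] q)"
  shows "\<not> perfect (difference_graph G)"
proof -
  let ?E = "edges (difference_graph G)"
  define u where "u = z [^] p"
  define v where "v = y [^] q"
  define w where "w = u \<otimes> v"
  have car: "u \<in> carrier G" "v \<in> carrier G" "w \<in> carrier G"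
    using yz by (simp_all add: u_def v_def w_def)
  have pq1: "p > 1" "q > 1" "\<not> p dvd q" "\<not> q dvd p"
    using pq prime_gt_1_nat primes_dvd_imp_eq by blast+
  have "coprime p q"
    using pq by (simp add: primes_coprime)
  have ord: "ord u = p" "ord v = q"
    using yz pq1 ord_pow_gen[of z p] ord_pow_gen[of y q]
    by (auto simp: u_def v_def power2_eq_square gcd_nat.absorb2)
  have uv: "u \<otimes> v = v \<otimes> u"
    using group_commutes_pow[of y u q] comm(1) yz(1) car by (simp add: u_def v_def)
  have ug: "u \<in> generate G {z}" and vg: "v \<in> generate G {y}"
    unfolding u_def v_def using yz generate_pow_on_finite_carrier[OF fin] by auto
  have uw: "u \<in> generate G {w}" and vw: "v \<in> generate G {w}"
    unfolding w_def using mem_generate_mult[OF car(1,2) uv] \<open>coprime p q\<close> ord by simp_all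
  have uy: "u \<in> generate G {u \<otimes> y}" "y \<in> generate G {u \<otimes> y}"
    using mem_generate_mult[OF car(1) yz(1)] comm(1) \<open>coprime p q\<close> ord yz by (simp_all add: u_def)
  have vz: "v \<in> generate G {v \<otimes> z}" "z \<in> generate G {v \<otimes> z}"
    using mem_generate_mult[OF car(2) yz(2)] comm(2) \<open>coprime p q\<close> ord yz
    by (simp_all add: v_def coprime_commute)
  have trans: "a \<in> generate G {c}" if "a \<in> generate G {b}" "b \<in> generate G {c}" "c \<in> carrier G" for a b c
    using generate_subgroup_incl[OF _ generate_is_subgroup, of "{b}" "{c}"] that by blast
  have mono: "a \<in> generate G {b, c}" if "a \<in> generate G {b}" for a b c
    using that mono_generate[of "{b}" "{b, c}"] by blast
  have mono': "a \<in> generate G {b, c}" if "a \<in> generate G {c}" for a b c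
    using that mono_generate[of "{c}" "{b, c}"] by blast
  have self: "a \<in> generate G {a}" for a
    by (simp add: generate.incl)
  \<comment> \<open>Since \<open>v\<close> is a power of \<open>y\<close> and \<open>u\<close> a
    power of \<open>z\<close>, both factors of \<open>w\<close> lie in each of the two cyclic
    groups.\<close>
  have ww: "w \<in> generate G {u \<otimes> y}" "w \<in> generate G {v \<otimes> z}"
    using uy vz trans[OF vg uy(2)] trans[OF ug vz(2)] yz car unfolding w_def
    by (auto intro: generate.eng)
  have dvdw: "p dvd ord w" "q dvd ord w"
    using ord_dvd_if_mem_generate[OF car(3) uw] ord_dvd_if_mem_generate[OF car(3) vw] ord by simp_all
  have "u [^] (p * q) = \<one>" "v [^] (p * q) = \<one>"
    using pow_eq_id car ord by simp_all
  then have "w [^] (p * q) = \<one>"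
    unfolding w_def using pow_mult_distrib[OF uv] car by simp
  then have ordw: "ord w dvd p * q"
    using car(3) pow_eq_id by simp
  have sq: "\<not> p\<^sup>2 dvd p * q" "\<not> q\<^sup>2 dvd p * q"
    using pq1 by (auto simp: power2_eq_square)
  have psq: "\<not> p dvd q\<^sup>2" "\<not> q dvd p\<^sup>2"
    using pq not_dvd_square_of_prime by auto
  \<comment> \<open>The product \<open>u \<otimes> y\<close> generates both \<open>w\<close> and
    \<open>y\<close>. The prime \<open>p\<close> divides \<open>ord w\<close> but not
    \<open>ord y\<close>, and \<open>q\<^sup>2\<close> does not divide \<open>p * q\<close>.\<close>
  have E1: "{w, y} \<in> ?E"
  proof (rule adjacentI[OF car(3) yz(1) _ _ generate.eng[OF mono[OF uw] mono'[OF self]] ww(1) uy(2)])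
    show "\<not> ord w dvd ord y" "\<not> ord y dvd ord w"
      using dvdw(1) ordw sq psq yz(3) dvd_trans by metis+
  qed
  have E2: "{y, u} \<in> ?E"
  proof (rule adjacentI[OF yz(1) car(1) _ _ generate.eng[OF mono'[OF self] mono[OF self]] uy(2,1)])
    show "\<not> ord y dvd ord u" "\<not> ord u dvd ord y"
      using ord yz(3) psq pq1(4) dvd_trans[of q "q\<^sup>2" p] by auto
  qed
  have E3: "{u, v} \<in> ?E"
    by (rule adjacentI[OF car(1,2) _ _ generate.eng[OF mono[OF self] mono'[OF self]]])
      (use ord pq1 uw vw in \<open>simp_all add: w_def\<close>)
  have E4: "{v, z} \<in> ?E"
  proof (rule adjacentI[OF car(2) yz(2) _ _ generate.eng[OF mono[OF self] mono'[OF self]] vz])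
    show "\<not> ord v dvd ord z" "\<not> ord z dvd ord v"
      using ord yz(4) psq pq1(3) dvd_trans[of p "p\<^sup>2" q] by auto
  qed
  have E5: "{z, w} \<in> ?E"
  proof (rule adjacentI[OF yz(2) car(3) _ _ generate.eng[OF mono'[OF vw] mono[OF self]] vz(2) ww(2)])
    show "\<not> ord z dvd ord w" "\<not> ord w dvd ord z"
      using dvdw(2) ordw sq psq yz(4) dvd_trans by metis+
  qed
  have N: "{a, b} \<notin> ?E" if "a \<in> carrier G" "b \<in> carrier G" "ord a dvd ord b \<or> ord b dvd ord a" for a b
    using ord_dvd_incomparable_if_adjacent[OF fin that(1,2)] that(3) by blast
  \<comment> \<open>Two powers of a common element would commute.\<close>
  have "{z, y} \<notin> ?E"
  proof
    assume "{z, y} \<in> ?E"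
    then obtain g where "g \<in> generate G {z, y}" "z \<in> generate G {g}" "y \<in> generate G {g}"
      using edges_difference_graph_iff[OF is_group yz(2,1)] by blast
    moreover from this have g: "g \<in> carrier G"
      using generate_in_carrier[of "{z, y}"] yz by blast
    ultimately obtain k l :: nat where "z = g [^] k" "y = g [^] l"
      using generate_pow_on_finite_carrier[OF fin g] by auto
    then have "y \<otimes> z = z \<otimes> y"
      using g by (simp add: nat_pow_mult add.commute)
    then show False
      using yz(5) by simp
  qed
  moreover have "{w, u} \<notin> ?E" "{y, v} \<notin> ?E" "{u, z} \<notin> ?E" "{v, w} \<notin> ?E"
    using N car yz dvdw ord by auto
  moreover have "{w, y, u, v, z} \<subseteq> verts (difference_graph G)"
    unfolding verts_difference_graph using E1 E2 E3 E4 E5 car yz(1,2) by blast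
  ultimately show ?thesis
    using not_perfect_if_induced_5_cycle[of w y u v z "difference_graph G"] E1 E2 E3 E4 E5 by blast
qed

end

section \<open>Semidirect products and the group of the theorem\<close>

lemma AutoGroup_simps:
  "carrier (AutoGroup G) = hom G G \<inter> Bij (carrier G)"
  "\<one>\<^bsub>AutoGroup G\<^esub> = (\<lambda>x \<in> carrier G. x)"
  by (simp_all add: AutoGroup_def BijGroup_def auto_def)

lemma AutoGroup_mult:
  assumes "f \<in> carrier (AutoGroup G)" "g \<in> carrier (AutoGroup G)" "x \<in> carrier G"
  shows "(f \<otimes>\<^bsub>AutoGroup G\<^esub> g) x = f (g x)"
  using assms by (simp add: AutoGroup_def BijGroup_def auto_def compose_def)

locale group_action_by_automorphisms =
  N: group N + K: group K + hom: group_hom K "AutoGroup N" \<phi>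
  for N (structure) and K and \<phi>
begin

lemma act_hom: "k \<in> carrier K \<Longrightarrow> group_hom N N (\<phi> k)"
  using hom.hom_closed[of k] by (simp add: AutoGroup_simps group_hom_def group_hom_axioms_def N.is_group)

lemma act_closed: "k \<in> carrier K \<Longrightarrow> n \<in> carrier N \<Longrightarrow> \<phi> k n \<in> carrier N"
  by (rule group_hom.hom_closed[OF act_hom])

lemma act_one: "n \<in> carrier N \<Longrightarrow> \<phi> \<one>\<^bsub>K\<^esub> n = n"
  unfolding hom.hom_one by (simp add: AutoGroup_simps)

lemma act_mult:
  "k \<in> carrier K \<Longrightarrow> l \<in> carrier K \<Longrightarrow> n \<in> carrier N \<Longrightarrow> \<phi> (k \<otimes>\<^bsub>K\<^esub> l) n = \<phi> k (\<phi> l n)"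
  by (simp add: AutoGroup_mult)

lemma group_semidirect_product: "group (semidirect_product N \<phi> K)"
proof (rule groupI)
  fix x y z
  assume "x \<in> carrier (semidirect_product N \<phi> K)" "y \<in> carrier (semidirect_product N \<phi> K)"
    "z \<in> carrier (semidirect_product N \<phi> K)"
  then show "x \<otimes>\<^bsub>semidirect_product N \<phi> K\<^esub> y \<otimes>\<^bsub>semidirect_product N \<phi> K\<^esub> z =
      x \<otimes>\<^bsub>semidirect_product N \<phi> K\<^esub> (y \<otimes>\<^bsub>semidirect_product N \<phi> K\<^esub> z)"
    by (auto simp: semidirect_product_def N.m_assoc K.m_assoc act_mult act_closed
        group_hom.hom_mult[OF act_hom] simp del: hom.hom_mult)
next
  fix x assume "x \<in> carrier (semidirect_product N \<phi> K)"
  then obtain n k where x: "x = (n, k)" "n \<in> carrier N" "k \<in> carrier K"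
    by (auto simp: semidirect_product_def)
  \<comment> \<open>The left inverse solves the second coordinate first; acting with that inverse on
    \<open>inv n\<close> then cancels the first.\<close>
  have "(\<phi> (inv\<^bsub>K\<^esub> k) (inv n), inv\<^bsub>K\<^esub> k) \<otimes>\<^bsub>semidirect_product N \<phi> K\<^esub> x = \<one>\<^bsub>semidirect_product N \<phi> K\<^esub>"
    using x group_hom.hom_mult[OF act_hom, of "inv\<^bsub>K\<^esub> k" "inv n" n]
      group_hom.hom_one[OF act_hom, of "inv\<^bsub>K\<^esub> k"]
    by (simp add: semidirect_product_def del: hom.hom_inv)
  then show "\<exists>y\<in>carrier (semidirect_product N \<phi> K).
      y \<otimes>\<^bsub>semidirect_product N \<phi> K\<^esub> x = \<one>\<^bsub>semidirect_product N \<phi> K\<^esub>"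
    by (rule bexI) (use x in \<open>auto simp: semidirect_product_def act_closed simp del: hom.hom_inv\<close>)
qed (auto simp: semidirect_product_def act_one act_closed simp del: hom.hom_one)

end

text \<open>A commutative image does not distinguish \<open>y \<otimes> z\<close> from
  \<open>z \<otimes> y\<close>. This serves the projections of the product onto its two outer
  coordinates.\<close>

lemma (in group_hom) commutator_in_kernel:
  assumes "comm_group H" "y \<in> carrier G" "z \<in> carrier G"
  shows "h ((y \<otimes> z) \<otimes> inv (z \<otimes> y)) = \<one>\<^bsub>H\<^esub>"
proof -
  have "h (y \<otimes> z) = h (z \<otimes> y)"
    using assms by (simp add: comm_group.axioms(1) comm_monoid.m_comm)
  then show ?thesis
    using assms by (simp del: hom_mult add: hom_mult[of "y \<otimes> z"])
qed

text \<open>Powers in the subgroup are formed with the operation and unit of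
  \<open>G\<close>.\<close>

lemma (in group) ord_subgroup:
  "subgroup H G \<Longrightarrow> group.ord (G\<lparr>carrier := H\<rparr>) x = ord x"
  unfolding ord_def group.ord_def[OF subgroup_imp_group] by (simp add: nat_pow_def)

lemma (in group) card_subgroup_dvd:
  assumes "subgroup H G" "subgroup K G" "H \<subseteq> K"
  shows "card H dvd card K"
proof -
  have "card (rcosets\<^bsub>G\<lparr>carrier := K\<rparr>\<^esub> H) * card H = card K"
    using group.lagrange[OF subgroup_imp_group[OF assms(2)] subgroup_incl[OF assms]]
    by (simp add: order_def)
  then show ?thesis
    by (metis dvd_triv_right)
qed

section \<open>The group of the theorem in coordinates\<close>

context
  fixes p q :: nat and \<phi> :: "int \<Rightarrow> int \<Rightarrow> int"
  assumes p: "Factorial_Ring.prime p" and q: "Factorial_Ring.prime q" and pq: "p \<noteq> q"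
    and \<phi>: "\<phi> \<in> hom (integer_mod_group (q\<^sup>2)) (AutoGroup (integer_mod_group p))"
begin

definition prod_group where
  "prod_group = integer_mod_group (p\<^sup>2) \<times>\<times>
      semidirect_product (integer_mod_group p) \<phi> (integer_mod_group (q\<^sup>2))"

interpretation act: group_action_by_automorphisms "integer_mod_group p" "integer_mod_group (q\<^sup>2)" \<phi>
  using \<phi> by (simp add: group_action_by_automorphisms_def group_hom_def group_hom_axioms_def
      group.AutoGroup)

text \<open>The integers modulo 0 are all integers, so positivity is what turns the carriers into
  intervals.\<close>

lemma pos: "p > 0" "q > 0"
  using p q prime_gt_0_nat by auto

lemma carrier_prod_group: "carrier prod_group = {0..<int (p\<^sup>2)} \<times> {0..<int p} \<times> {0..<int (q\<^sup>2)}"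
  using pos by (simp add: prod_group_def semidirect_product_def carrier_integer_mod_group)

lemma mult_prod_group:
  "(a, b, c) \<otimes>\<^bsub>prod_group\<^esub> (a', b', c') =
    ((a + a') mod int (p\<^sup>2), (b + \<phi> c b') mod int p, (c + c') mod int (q\<^sup>2))"
  by (simp add: prod_group_def semidirect_product_def)

lemma one_prod_group: "\<one>\<^bsub>prod_group\<^esub> = (0, 0, 0)"
  by (simp add: prod_group_def semidirect_product_def)

interpretation group prod_group
  unfolding prod_group_def by (simp add: DirProd_group act.group_semidirect_product)

lemma finite_prod_group: "finite (carrier prod_group)"
  by (simp add: carrier_prod_group)

lemma act_zero: "\<phi> 0 b = b" if "b \<in> {0..<int p}"
  using act.act_one[of b] that pos by (simp add: carrier_integer_mod_group)

lemma act_to_zero: "\<phi> c 0 = 0" if "c \<in> {0..<int (q\<^sup>2)}"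
  using group_hom.hom_one[OF act.act_hom, of c] that pos by (simp add: carrier_integer_mod_group)

interpretation f1: group_hom prod_group "integer_mod_group (p\<^sup>2)" fst
proof (intro group_hom.intro group_hom_axioms.intro group_integer_mod_group group_axioms)
  show "fst \<in> hom prod_group (integer_mod_group (p\<^sup>2))"
    by (auto simp: hom_def prod_group_def mult_DirProd')
qed

interpretation f3: group_hom prod_group "integer_mod_group (q\<^sup>2)" "\<lambda>g. snd (snd g)"
proof (intro group_hom.intro group_hom_axioms.intro group_integer_mod_group group_axioms)
  show "(\<lambda>g. snd (snd g)) \<in> hom prod_group (integer_mod_group (q\<^sup>2))"
    by (auto simp: hom_def prod_group_def mult_DirProd' semidirect_product_def)
qed

text \<open>Since 0 acts trivially, elements with last coordinate 0 multiply componentwise.\<close>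

lemma pow_kernel:
  assumes "a \<in> {0..<int (p\<^sup>2)}" "b \<in> {0..<int p}"
  shows "(a, b, 0) [^]\<^bsub>prod_group\<^esub> (n::nat) = (int n * a mod int (p\<^sup>2), int n * b mod int p, 0)"
proof (induction n)
  case (Suc n)
  show ?case
    using assms pos by (simp add: Suc mult_prod_group act_zero mod_simps algebra_simps)
qed (simp add: one_prod_group)

text \<open>Every automorphism fixes 0, so only the last coordinate accumulates.\<close>

lemma pow_complement:
  assumes "c \<in> {0..<int (q\<^sup>2)}"
  shows "(0, 0, c) [^]\<^bsub>prod_group\<^esub> (n::nat) = (0, 0, int n * c mod int (q\<^sup>2))"
proof (induction n)
  case (Suc n)
  show ?case
    using assms pos by (simp add: Suc mult_prod_group act_to_zero mod_simps algebra_simps)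
qed (simp add: one_prod_group)

text \<open>The power with exponent \<open>q\<^sup>2\<close> has last coordinate 0, and
  \<open>p\<^sup>2\<close> annihilates both remaining coordinates.\<close>

lemma ord_dvd:
  assumes "g \<in> carrier prod_group"
  shows "ord g dvd p\<^sup>2 * q\<^sup>2"
proof -
  have car: "g [^]\<^bsub>prod_group\<^esub> (q\<^sup>2) \<in> carrier prod_group"
    using assms by simp
  have "snd (snd (g [^]\<^bsub>prod_group\<^esub> (q\<^sup>2))) = 0"
    using assms f3.hom_nat_pow[of g "q\<^sup>2"] by simp
  then obtain a b where ab: "g [^]\<^bsub>prod_group\<^esub> (q\<^sup>2) = (a, b, 0)" "a \<in> {0..<int (p\<^sup>2)}" "b \<in> {0..<int p}"
    using car unfolding carrier_prod_group by (metis mem_Times_iff prod.collapse)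
  have "g [^]\<^bsub>prod_group\<^esub> (q\<^sup>2 * p\<^sup>2) = \<one>\<^bsub>prod_group\<^esub>"
    using ab assms by (simp add: pow_kernel one_prod_group power2_eq_square mult.assoc flip: nat_pow_pow)
  then show ?thesis
    using assms pow_eq_id by (simp add: mult.commute)
qed

text \<open>
  The commutator \<open>w\<close> of \<open>y\<close> and \<open>z\<close> lies in the normal subgroup \<open>P\<close> of order \<open>p\<^sup>3\<close> and has trivial
  first component, so it is not a power of \<open>z\<close>, whose first component is a unit. Hence \<open>H \<inter> P\<close> has more
  than \<open>p\<^sup>2\<close> elements, that is, \<open>P \<subseteq> H\<close>.
\<close>

lemma commuting_in_proper_subgroup:
  assumes H: "subgroup H prod_group" "H \<noteq> carrier prod_group"
    and y: "y \<in> H" "ord y = q\<^sup>2" and z: "z \<in> H" "ord z = p\<^sup>2"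
  shows "y \<otimes>\<^bsub>prod_group\<^esub> z = z \<otimes>\<^bsub>prod_group\<^esub> y"
proof (rule ccontr)
  assume ne: "y \<otimes>\<^bsub>prod_group\<^esub> z \<noteq> z \<otimes>\<^bsub>prod_group\<^esub> y"
  have car: "y \<in> carrier prod_group" "z \<in> carrier prod_group"
    using H y z subgroup.mem_carrier by fast+
  define w where "w = (y \<otimes>\<^bsub>prod_group\<^esub> z) \<otimes>\<^bsub>prod_group\<^esub> inv\<^bsub>prod_group\<^esub> (z \<otimes>\<^bsub>prod_group\<^esub> y)"
  have wcar: "w \<in> carrier prod_group"
    using car by (simp add: w_def)
  have wH: "w \<in> H"
    unfolding w_def using H y z by (simp add: subgroup.m_closed subgroup.m_inv_closed)
  have w_ne: "w \<noteq> \<one>\<^bsub>prod_group\<^esub>"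
    using ne car unfolding w_def by (metis inv_solve_right' l_one m_closed one_closed)
  have w1: "fst w = 0" and w3: "snd (snd w) = 0"
    unfolding w_def using f1.commutator_in_kernel f3.commutator_in_kernel car by simp_all
  obtain a b c where abc: "z = (a, b, c)" "a \<in> {0..<int (p\<^sup>2)}" "b \<in> {0..<int p}" "c \<in> {0..<int (q\<^sup>2)}"
    using car(2) unfolding carrier_prod_group by blast
  have coprime: "coprime (p ^ m) (q ^ n)" for m n
    using p q pq by (simp add: primes_coprime)
  \<comment> \<open>The last coordinate of this power shows that \<open>q\<^sup>2\<close> divides
    \<open>p\<^sup>2 * c\<close>, hence \<open>c\<close>, so that \<open>c\<close> is 0 and
    \<open>z\<close> lies in the kernel of the last projection.\<close>
  have "z [^]\<^bsub>prod_group\<^esub> (p\<^sup>2) = \<one>\<^bsub>prod_group\<^esub>"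
    using car(2) z(2) pow_eq_id by simp
  then have "int (p\<^sup>2) * c mod int (q\<^sup>2) = 0"
    using f3.hom_nat_pow[OF car(2), of "p\<^sup>2"] by (simp add: abc one_prod_group)
  then have "int (q\<^sup>2) dvd c"
    using coprime[of 2 2] by (metis coprime_commute coprime_dvd_mult_right_iff coprime_int_iff mod_0_imp_dvd)
  then have c: "c = 0"
    using abc(4) zdvd_not_zless[of c "int (q\<^sup>2)"] by force
  \<comment> \<open>Otherwise the exponent \<open>p\<close> would already annihilate both
    coordinates of \<open>z\<close>.\<close>
  have a: "\<not> int p dvd a"
  proof
    assume "int p dvd a"
    then have "int p * a mod int (p\<^sup>2) = 0"
      by (simp add: power2_eq_square)
    then have "z [^]\<^bsub>prod_group\<^esub> p = \<one>\<^bsub>prod_group\<^esub>"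
      using abc c by (simp add: pow_kernel one_prod_group)
    then have "p\<^sup>2 dvd p"
      using car(2) z(2) pow_eq_id by simp
    then show False
      using dvd_imp_le[of "p\<^sup>2" p] prime_gt_1_nat[OF p] by (simp add: power2_eq_square)
  qed
  have w_notin: "w \<notin> generate prod_group {z}"
  proof
    assume "w \<in> generate prod_group {z}"
    then obtain k :: nat where k: "w = z [^]\<^bsub>prod_group\<^esub> k"
      using generate_pow_on_finite_carrier[OF finite_prod_group car(2)] by auto
    then have "int (p\<^sup>2) dvd int k * a"
      using w1 abc c by (simp add: pow_kernel mod_0_imp_dvd)
    moreover have "coprime (int (p\<^sup>2)) a"
      using a p by (simp add: prime_imp_coprime)
    ultimately have "p\<^sup>2 dvd k"
      by (metis coprime_dvd_mult_left_iff int_dvd_int_iff)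
    then have "w = \<one>\<^bsub>prod_group\<^esub>"
      unfolding k using car(2) z(2) pow_eq_id by simp
    then show False
      using w_ne by simp
  qed
  define P where "P = kernel prod_group (integer_mod_group (q\<^sup>2)) (\<lambda>g. snd (snd g))"
  have subP: "subgroup P prod_group"
    unfolding P_def by (rule f3.subgroup_kernel)
  have "P = {0..<int (p\<^sup>2)} \<times> {0..<int p} \<times> {0}"
    using pos by (auto simp: P_def kernel_def carrier_prod_group)
  then have cardP: "card P = p ^ 3"
    by (simp add: card_cartesian_product nat_power_eq flip: power_Suc2)
  have subHP: "subgroup (H \<inter> P) prod_group"
    using H(1) subP by (rule subgroups_Inter_pair)
  have "w \<in> P" "z \<in> P"
    using wcar w3 car(2) abc(1) c by (auto simp: P_def kernel_def)
  then have "generate prod_group {z} \<subset> H \<inter> P"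
    using generate_subgroup_incl[OF _ subHP, of "{z}"] z(1) wH w_notin by blast
  moreover have "finite (H \<inter> P)"
    using finite_subset[OF subgroup.subset[OF subHP] finite_prod_group] .
  ultimately have "p\<^sup>2 < card (H \<inter> P)"
    using psubset_card_mono[of "H \<inter> P" "generate prod_group {z}"] generate_pow_card[OF car(2)] z(2) by simp
  moreover have "card (H \<inter> P) dvd p ^ 3"
    using card_subgroup_dvd[OF subHP subP] cardP by simp
  then obtain i where i: "i \<le> 3" "card (H \<inter> P) = p ^ i"
    using divides_primepow_nat[OF p] by auto
  ultimately have "2 < i"
    using power_less_imp_less_exp[OF prime_gt_1_nat[OF p], of 2 i] by simp
  then have "i = 3"
    using i(1) by simp
  then have "p ^ 3 dvd card H"
    using i(2) card_subgroup_dvd[OF subHP H(1)] by simp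
  \<comment> \<open>The powers of \<open>y\<close> contribute the factor prime to \<open>p\<close>,
    so \<open>card H\<close> reaches the order of the whole group.\<close>
  moreover have "q\<^sup>2 dvd card H"
    using card_subgroup_dvd[OF generate_is_subgroup H(1), of "{y}"] y car(1)
      generate_subgroup_incl[OF _ H(1), of "{y}"] generate_pow_card[OF car(1)] by simp
  ultimately have "p ^ 3 * q\<^sup>2 dvd card H"
    using coprime[of 3 2] by (intro divides_mult)
  moreover have "card (carrier prod_group) = p ^ 3 * q\<^sup>2"
    by (simp add: carrier_prod_group card_cartesian_product nat_power_eq flip: mult.assoc power_Suc2)
  moreover have "card H > 0"
    using y(1) finite_subset[OF subgroup.subset[OF H(1)] finite_prod_group] card_gt_0_iff by blast
  ultimately have "card (carrier prod_group) \<le> card H"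
    by (simp add: dvd_imp_le)
  then have "H = carrier prod_group"
    using card_seteq[OF finite_prod_group subgroup.subset[OF H(1)]] by simp
  then show False
    using H(2) by simp
qed

text \<open>The witnesses are \<open>y = (0, 0, x)\<close> and \<open>z = (1, b, 0)\<close>, where
  \<open>b\<close> is moved by \<open>\<phi> x\<close>. The power \<open>z [^] p\<close> has middle
  coordinate 0, which is fixed by the action, and \<open>y [^] q\<close> acts trivially because
  \<open>\<phi> x\<close> has order \<open>q\<close>.\<close>

lemma not_perfect_difference_graph_prod_group:
  assumes x: "x \<in> carrier (integer_mod_group (q\<^sup>2))"
    and gen: "generate (integer_mod_group (q\<^sup>2)) {x} = carrier (integer_mod_group (q\<^sup>2))"
    and ord: "group.ord (AutoGroup (integer_mod_group p)) (\<phi> x) = q"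
  shows "\<not> perfect (difference_graph prod_group)"
proof -
  have gt: "p > 1" "q > 1"
    using p q prime_gt_1_nat by auto
  have x_car: "x \<in> {0..<int (q\<^sup>2)}"
    using x pos by (simp add: carrier_integer_mod_group)
  have car_p: "carrier (integer_mod_group p) = {0..<int p}"
    using pos by (simp add: carrier_integer_mod_group)
  have "\<phi> x \<noteq> \<one>\<^bsub>AutoGroup (integer_mod_group p)\<^esub>"
    using act.hom.H.ord_id ord gt by auto
  \<comment> \<open>Both \<open>\<phi> x\<close> and the identity of the automorphism group are
    extensional, so being different they differ at a point of the carrier.\<close>
  moreover have "\<phi> x \<in> extensional {0..<int p}"
    using act.hom.hom_closed[OF x] by (simp add: AutoGroup_simps Bij_def car_p)
  ultimately obtain b where b: "b \<in> {0..<int p}" "\<phi> x b \<noteq> b"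
    unfolding AutoGroup_simps car_p by (metis extensionalityI restrict_apply' restrict_extensional)
  have act_pow: "\<phi> (int q * x mod int (q\<^sup>2)) b = b"
  proof -
    have "\<phi> (x [^]\<^bsub>integer_mod_group (q\<^sup>2)\<^esub> q) = \<one>\<^bsub>AutoGroup (integer_mod_group p)\<^esub>"
      using act.hom.hom_nat_pow[OF x, of q] act.hom.H.pow_ord_eq_1[OF act.hom.hom_closed[OF x]] ord
      by simp
    then show ?thesis
      using b(1) by (simp add: AutoGroup_simps car_p)
  qed
  \<comment> \<open>All multiples of \<open>x\<close> modulo \<open>q\<^sup>2\<close> would be
    divisible by \<open>q\<close>, but 1 is among them. This later gives \<open>y\<close> the full
    order \<open>q\<^sup>2\<close>.\<close>
  have "\<not> int q dvd x"
  proof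
    assume "int q dvd x"
    have "1 \<in> generate (integer_mod_group (q\<^sup>2)) {x}"
      using gt by (simp add: gen power_eq_1_iff)
    then obtain k :: int where "1 = k * x mod int (q\<^sup>2)"
      using group.generate_pow[OF group_integer_mod_group x] by (auto simp: int_pow_integer_mod_group)
    moreover have "int q dvd k * x mod int (q\<^sup>2)"
      using \<open>int q dvd x\<close> by (simp add: dvd_mod power2_eq_square)
    ultimately show False
      using gt by simp
  qed
  define y where "y = (0::int, 0::int, x)"
  define z where "z = (1::int, b, 0::int)"
  have "p < p\<^sup>2"
    using gt by (simp add: power2_eq_square)
  then have "int p < int (p\<^sup>2)"
    by (simp only: of_nat_less_iff)
  then have bounds: "1 \<in> {0..<int (p\<^sup>2)}" "int p < int (p\<^sup>2)" "0 \<in> {0..<int p}"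
    using gt by auto
  have car: "y \<in> carrier prod_group" "z \<in> carrier prod_group"
    using x_car b(1) bounds pos by (auto simp: y_def z_def carrier_prod_group)
  have y_pow: "y [^]\<^bsub>prod_group\<^esub> n = (0, 0, int n * x mod int (q\<^sup>2))" for n :: nat
    unfolding y_def by (rule pow_complement[OF x_car])
  have z_pow: "z [^]\<^bsub>prod_group\<^esub> n = (int n mod int (p\<^sup>2), int n * b mod int p, 0)" for n :: nat
    unfolding z_def using pow_kernel[OF bounds(1) b(1)] by simp
  have y_ord: "ord y = q\<^sup>2"
  proof (rule ord_eq_prime_square[OF car(1) q])
    show "y [^]\<^bsub>prod_group\<^esub> q \<noteq> \<one>\<^bsub>prod_group\<^esub>"
      using \<open>\<not> int q dvd x\<close> pos by (auto simp: y_pow one_prod_group power2_eq_square)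
  qed (simp add: y_pow one_prod_group)
  have z_ord: "ord z = p\<^sup>2"
  proof (rule ord_eq_prime_square[OF car(2) p])
    show "z [^]\<^bsub>prod_group\<^esub> p \<noteq> \<one>\<^bsub>prod_group\<^esub>"
      using bounds(2) pos by (simp add: z_pow one_prod_group)
  qed (simp add: z_pow one_prod_group power2_eq_square)
  \<comment> \<open>The middle coordinates of the two products are \<open>\<phi> x b\<close> and
    \<open>b\<close>; the bounds make reduction modulo \<open>p\<close> harmless.\<close>
  have "0 \<le> \<phi> x b" "\<phi> x b < int p"
    using act.act_closed[OF x, of b] b(1) by (auto simp: car_p)
  then have "y \<otimes>\<^bsub>prod_group\<^esub> z \<noteq> z \<otimes>\<^bsub>prod_group\<^esub> y"
    using b bounds by (simp add: y_def z_def mult_prod_group act_zero)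
  moreover have "z [^]\<^bsub>prod_group\<^esub> p \<otimes>\<^bsub>prod_group\<^esub> y = y \<otimes>\<^bsub>prod_group\<^esub> z [^]\<^bsub>prod_group\<^esub> p"
    using x_car bounds pos unfolding z_pow by (simp add: y_def mult_prod_group act_zero act_to_zero)
  moreover have "y [^]\<^bsub>prod_group\<^esub> q \<otimes>\<^bsub>prod_group\<^esub> z = z \<otimes>\<^bsub>prod_group\<^esub> y [^]\<^bsub>prod_group\<^esub> q"
    using b(1) bounds pos act_pow unfolding y_pow by (simp add: z_def mult_prod_group act_zero)
  ultimately show ?thesis
    using not_perfect_difference_graph_if_not_commuting[OF finite_prod_group p q pq car y_ord z_ord] by blast
qed

text \<open>Orders and products in \<open>H\<close> are those of the whole group, so the bound on
  orders and the commutation result carry over to the comparability criterion.\<close>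

lemma perfect_difference_graph_proper_subgroup:
  assumes H: "subgroup H prod_group" "H \<noteq> carrier prod_group"
  shows "perfect (difference_graph (prod_group\<lparr>carrier := H\<rparr>))"
proof (rule group.perfect_difference_graph_if_commuting[OF subgroup_imp_group[OF H(1)] _ p q pq])
  show "finite (carrier (prod_group\<lparr>carrier := H\<rparr>))"
    using finite_subset[OF subgroup.subset[OF H(1)] finite_prod_group] by simp
qed (use H commuting_in_proper_subgroup[OF H] ord_dvd subgroup.mem_carrier[OF H(1)]
    in \<open>simp_all add: ord_subgroup\<close>)

lemma is_group_prod_group: "group prod_group"
  by (rule group_axioms)

end

theorem theorem7p9:
  fixes p q :: nat and x :: int and \<psi> :: "int \<Rightarrow> int" and \<phi> :: "int \<Rightarrow> int \<Rightarrow> int"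
  assumes "Factorial_Ring.prime p" and "Factorial_Ring.prime q" and "p \<noteq> q" and "q dvd p - 1"
    and "x \<in> carrier (integer_mod_group (q\<^sup>2))"
    and "generate (integer_mod_group (q\<^sup>2)) {x} = carrier (integer_mod_group (q\<^sup>2))"
    and "\<psi> \<in> carrier (AutoGroup (integer_mod_group p))"
    and "group.ord (AutoGroup (integer_mod_group p)) \<psi> = q"
    and "\<phi> \<in> hom (integer_mod_group (q\<^sup>2)) (AutoGroup (integer_mod_group p))"
    and "\<phi> x = \<psi>"
  shows "minimal_imperfect_group
           (integer_mod_group (p\<^sup>2) \<times>\<times>
            semidirect_product (integer_mod_group p) \<phi> (integer_mod_group (q\<^sup>2)))"
  unfolding minimal_imperfect_group_def prod_group_def[OF assms(1-3,9), symmetric]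
  using is_group_prod_group not_perfect_difference_graph_prod_group perfect_difference_graph_proper_subgroup assms
  by blast

end
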